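(* Let $\alpha>0$, $\beta>0$, and let $X$ be a random variable following the unit-Gompertz distribution $UG(\alpha,\beta)$. Then for every positive integer $n$ and every $x\in(0,1)$, $$E\left(X^{n}\mid X>x\right)=\frac{e^{\alpha}\alpha^{n/\beta}\left[\Gamma\left(1-\frac{n}{\beta};\alpha\right)-\Gamma\left(1-\frac{n}{\beta};\frac{\alpha}{x^{\beta}}\right)\right]}{1-\exp\left[-\alpha\left(1/x^{\beta}-1\right)\right]},$$ where $\Gamma(s;y)=\int_{y}^{\infty}t^{s-1}e^{-t}\,dt$ (for real $s$ and $y>0$) is the upper incomplete gamma function.
   Context: The unit-Gompertz distribution $UG(\alpha,\beta)$ with shape parameter $\alpha>0$ and scale parameter $\beta>0$ is the distribution supported on $(0,1)$ with probability density function $$f(x\mid\alpha,\beta)=\frac{\alpha\beta\exp\left[-\alpha\left(1/x^{\beta}-1\right)\right]}{x^{1+\beta}},\qquad x\in(0,1),$$ and cumulative distribution function $F(x\mid\alpha,\beta)=\exp\left[-\alpha\left(1/x^{\beta}-1\right)\right]$ for $x\in(0,1)$. Here $E(X^n\mid X>x)$ denotes the conditional expectation of $X^n$ given the event $\{X>x\}$, that is, $\frac{1}{1-F(x\mid\alpha,\beta)}\int_x^1 y^n f(y\mid\alpha,\beta)\,dy$. *)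

theory Defs
  imports "HOL-Probability.Probability"
begin

definition ug_density :: "real \<Rightarrow> real \<Rightarrow> real \<Rightarrow> real" where
  "ug_density \<alpha> \<beta> x =
     (if 0 < x \<and> x < 1
      then \<alpha> * \<beta> * exp (- \<alpha> * (1 / x powr \<beta> - 1)) / x powr (1 + \<beta>)
      else 0)"

text \<open>The integral converges for every real \<open>s\<close> as soon as \<open>y > 0\<close>; for \<open>y \<le> 0\<close> the
  value carries no meaning in general.\<close>

definition upper_inc_gamma :: "real \<Rightarrow> real \<Rightarrow> real" where
  "upper_inc_gamma s y = (LBINT t:{y<..}. t powr (s - 1) * exp (- t))"

text \<open>The expectation of \<open>Y\<close> given the event \<open>A\<close>: \<open>uniform_measure M A\<close> is the measure
  \<open>B \<mapsto> emeasure M (A \<inter> B) / emeasure M A\<close>, i.e. conditioning on \<open>A\<close> for an arbitrary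
  probability space \<open>M\<close>, despite its name.\<close>

definition event_cond_exp :: "'a measure \<Rightarrow> ('a \<Rightarrow> real) \<Rightarrow> 'a set \<Rightarrow> real" where
  "event_cond_exp M Y A = (\<integral>\<omega>. Y \<omega> \<partial>uniform_measure M A)"

end

theory Submission
  imports Defs
begin

text \<open>The substitution \<open>t = \<alpha> / y\<^sup>\<beta>\<close> turns the truncated moment \<open>\<integral>\<^sub>x\<^sup>1 y\<^sup>n f(y) dy\<close> into
  \<open>e\<^sup>\<alpha> \<alpha>\<^bsup>n/\<beta>\<^esup>\<close> times the integral of \<open>t\<^bsup>-n/\<beta>\<^esup> e\<^bsup>-t\<^esup>\<close> from \<open>\<alpha>\<close> to \<open>\<alpha> / x\<^sup>\<beta>\<close>, which is a
  difference of incomplete gamma functions. The case \<open>n = 0\<close> gives the probability of the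
  conditioning event.\<close>

text \<open>For \<open>t > y\<close> and \<open>k \<ge> 0\<close> the factor
  \<open>t powr (- k)\<close> is at most \<open>y powr (- k)\<close>, so the integrand is dominated
  by a multiple of the Gamma integrand with parameter \<open>s + k\<close>. The shift is what
  reaches \<open>s \<le> 0\<close>, where the Gamma integral itself diverges at 0; this occurs below
  for \<open>s = 1 - n / \<beta>\<close> as soon as \<open>n \<ge> \<beta>\<close>.\<close>

lemma set_integrable_upper_inc_gamma:
  fixes s y :: real
  assumes "y > 0"
  shows "set_integrable lborel {y<..} (\<lambda>t. t powr (s - 1) * exp (- t))"
proof -
  \<comment> \<open>Any \<open>k \<ge> 0\<close> with \<open>s + k > 0\<close> would do; this choice
    covers both signs of \<open>s\<close>.\<close>
  define k where "k = \<bar>s\<bar> + 1"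
  have pos: "s + k > 0" "k \<ge> 0" by (auto simp: k_def)
  have "(\<lambda>t. t powr (s + k - 1) / exp t) absolutely_integrable_on {0..}"
    using Gamma_integral_real[OF pos(1)]
    by (intro nonnegative_absolutely_integrable_1) (auto simp: integrable_on_def)
  \<comment> \<open>Absolute integrability refers to the completed measure; Borel measurability of
    the integrand brings it back to \<open>lborel\<close>.\<close>
  hence "integrable lborel (\<lambda>t. indicator {0..} t *\<^sub>R (t powr (s + k - 1) / exp t))"
    unfolding set_integrable_def by (subst (asm) integrable_completion) auto
  hence "set_integrable lborel {0..} (\<lambda>t. t powr (s + k - 1) / exp t)"
    by (simp add: set_integrable_def)
  hence "set_integrable lborel {y<..} (\<lambda>t. t powr (s + k - 1) / exp t)"
    by (rule set_integrable_subset) (use assms in auto)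
  hence "set_integrable lborel {y<..} (\<lambda>t. (1 / y powr k) * (t powr (s + k - 1) / exp t))"
    by (rule set_integrable_mult_right)
  thus ?thesis
  proof (rule set_integrable_bound)
    show "set_borel_measurable lborel {y<..} (\<lambda>t. t powr (s - 1) * exp (- t))"
      unfolding set_borel_measurable_def by measurable
    have "t powr (s - 1) * exp (- t) \<le> 1 / y powr k * (t powr (s + k - 1) / exp t)"
      if "t > y" for t
    proof -
      have "t powr (s + k - 1) = t powr (s - 1) * t powr k"
        by (simp add: powr_add[symmetric] algebra_simps)
      moreover have "y powr k \<le> t powr k"
        using that assms pos by (intro powr_mono2) auto
      ultimately show ?thesis
        using assms by (simp add: exp_minus field_simps mult_right_mono)
    qed
    thus "AE t in lborel. t \<in> {y<..} \<longrightarrow> norm (t powr (s - 1) * exp (- t))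
        \<le> norm (1 / y powr k * (t powr (s + k - 1) / exp t))"
      by auto
  qed
qed

text \<open>The half-line above \<open>a\<close> splits at \<open>b\<close> and the common tail
  cancels. Additivity needs both pieces integrable, which they inherit from the half-line because
  \<open>a > 0\<close>.\<close>

lemma upper_inc_gamma_diff:
  fixes s a b :: real
  assumes "0 < a" "a \<le> b"
  shows "upper_inc_gamma s a - upper_inc_gamma s b = (LBINT t=a..b. t powr (s - 1) * exp (- t))"
proof -
  let ?f = "\<lambda>t::real. t powr (s - 1) * exp (- t)"
  have ia: "set_integrable lborel {a<..} ?f"
    using assms by (intro set_integrable_upper_inc_gamma) auto
  have "(LBINT t:{a<..b} \<union> {b<..}. ?f t) = (LBINT t:{a<..b}. ?f t) + (LBINT t:{b<..}. ?f t)"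
    using assms by (intro set_integral_Un set_integrable_subset[OF ia]) auto
  moreover have "{a<..b} \<union> {b<..} = {a<..}" using assms by auto
  ultimately show ?thesis
    using assms by (simp add: upper_inc_gamma_def interval_integral_Ioc)
qed

lemma borel_measurable_ug_density [measurable]: "ug_density \<alpha> \<beta> \<in> borel_measurable borel"
  unfolding ug_density_def by measurable

lemma ug_density_nonneg: "\<alpha> > 0 \<Longrightarrow> \<beta> > 0 \<Longrightarrow> ug_density \<alpha> \<beta> y \<ge> 0"
  by (simp add: ug_density_def)

lemma ug_truncated_moment:
  fixes \<alpha> \<beta> x :: real and n :: nat
  assumes "\<alpha> > 0" "\<beta> > 0" "0 < x" "x < 1"
  shows "(\<integral>y. ug_density \<alpha> \<beta> y * (indicator {x<..} y * y ^ n) \<partial>lborel) =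
    exp \<alpha> * \<alpha> powr (real n / \<beta>) *
      (LBINT t=\<alpha>..\<alpha> / x powr \<beta>. t powr (- real n / \<beta>) * exp (- t))"
proof -
  define g where "g = (\<lambda>y::real. \<alpha> * y powr - \<beta>)"
  define g' where "g' = (\<lambda>y::real. \<alpha> * (- \<beta> * y powr (- \<beta> - 1)))"
  define f where "f = (\<lambda>t::real. t powr (- real n / \<beta>) * exp (- t))"
  define C where "C = exp \<alpha> * \<alpha> powr (real n / \<beta>)"
  \<comment> \<open>With \<open>t = g y\<close>, the power \<open>t powr (- n / \<beta>)\<close>
    produces \<open>y ^ n\<close> and a factor \<open>\<alpha> powr (- n / \<beta>)\<close>. The
    constant \<open>C\<close> cancels that factor and supplies the \<open>exp \<alpha>\<close> of
    the density. The minus sign is there because \<open>g\<close> is decreasing.\<close>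
  have integrand: "ug_density \<alpha> \<beta> y * y ^ n = - C * (g' y *\<^sub>R f (g y))" if "y \<in> {x<..<1}" for y
  proof -
    have y: "0 < y" "y < 1" using that assms by auto
    have "(g y) powr (- real n / \<beta>) = \<alpha> powr (- real n / \<beta>) * y powr (real n)"
      using assms y by (simp add: g_def powr_mult powr_powr)
    hence fg: "f (g y) = \<alpha> powr (- real n / \<beta>) * y ^ n * exp (- g y)"
      using y by (simp add: f_def powr_realpow)
    have C: "C * \<alpha> powr (- real n / \<beta>) = exp \<alpha>"
      using assms by (simp add: C_def powr_add[symmetric])
    have "- C * (g' y *\<^sub>R f (g y)) = (C * \<alpha> powr (- real n / \<beta>)) * exp (- g y) * - g' y * y ^ n"
      by (simp add: fg mult_ac)
    also have "\<dots> = exp (\<alpha> - g y) * - g' y * y ^ n"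
      by (simp only: C exp_add[symmetric]) simp
    also have "\<alpha> - g y = - \<alpha> * (1 / y powr \<beta> - 1)"
      using y by (simp add: g_def powr_minus field_simps)
    also have "- g' y = \<alpha> * \<beta> / y powr (1 + \<beta>)"
      using powr_minus[of y "\<beta> + 1"]
      by (simp add: g'_def divide_inverse add.commute[of 1])
    finally show ?thesis using y by (simp add: ug_density_def)
  qed
  \<comment> \<open>The density vanishes from 1 on, which cuts the half-line down to a bounded
    interval.\<close>
  have "(\<integral>y. ug_density \<alpha> \<beta> y * (indicator {x<..} y * y ^ n) \<partial>lborel) =
      (LBINT y:{x<..<1}. ug_density \<alpha> \<beta> y * y ^ n)"
    unfolding set_lebesgue_integral_def
    by (intro Bochner_Integration.integral_cong) (auto simp: ug_density_def indicator_def)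
  also have "\<dots> = (LBINT y:{x<..<1}. - C * (g' y *\<^sub>R f (g y)))"
    using integrand by (intro set_lebesgue_integral_cong) auto
  also have "\<dots> = - C * (LBINT y=x..1. g' y *\<^sub>R f (g y))"
    using assms by (simp only: set_integral_mult_right)
      (simp add: interval_integral_Ioo one_ereal_def del: ereal_eq_1)
  also have "(LBINT y=x..1. g' y *\<^sub>R f (g y)) = (LBINT t=g x..g 1. f t)"
    unfolding one_ereal_def
  proof (rule interval_integral_substitution_finite)
    show "(g has_real_derivative g' y) (at y within {x..1})" if "x \<le> y" "y \<le> 1" for y
      unfolding g_def g'_def
      by (rule DERIV_cmult, rule DERIV_subset[OF has_real_derivative_powr]) (use that assms in auto)
    \<comment> \<open>Continuity of \<open>f\<close> is only needed on the image of
      \<open>g\<close>, which stays away from the singularity at 0.\<close>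
    have "g ` {x..1} \<subseteq> {0<..}" using assms by (auto simp: g_def)
    thus "continuous_on (g ` {x..1}) f"
      unfolding f_def by (intro continuous_intros) auto
    show "continuous_on {x..1} g'"
      unfolding g'_def using assms by (intro continuous_intros) auto
  qed (use assms in auto)
  \<comment> \<open>Since \<open>g\<close> is decreasing, the limits come out in the wrong order;
    reversing them cancels the sign in \<open>- C\<close>.\<close>
  also have "\<dots> = - (LBINT t=g 1..g x. f t)"
    by (rule interval_integral_endpoints_reverse)
  also have "g 1 = \<alpha>" by (simp add: g_def)
  also have "g x = \<alpha> / x powr \<beta>" using assms by (simp add: g_def powr_minus divide_inverse)
  finally show ?thesis by (simp add: C_def f_def)
qed

lemma interval_integral_exp_minus:
  fixes a b :: real
  shows "(LBINT t=a..b. exp (- t)) = exp (- a) - exp (- b)"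
proof -
  have "(LBINT t=a..b. exp (- t)) = - exp (- b) - (- exp (- a))"
    by (rule interval_integral_FTC_finite)
      (auto intro!: continuous_intros derivative_eq_intros
         simp: has_real_derivative_iff_has_vector_derivative[symmetric])
  thus ?thesis by simp
qed

text \<open>Conditioning on an event of positive measure amounts to the density
  \<open>indicator A / measure M A\<close>; positivity lets the \<open>ennreal\<close> quotient be
  read as a real one.\<close>

lemma event_cond_exp_eq:
  assumes "finite_measure M" "A \<in> sets M" "measure M A > 0" "Y \<in> borel_measurable M"
  shows "event_cond_exp M Y A = (\<integral>\<omega>. indicator A \<omega> * Y \<omega> \<partial>M) / measure M A"
proof -
  interpret finite_measure M by fact
  have "uniform_measure M A = density M (\<lambda>\<omega>. ennreal (indicator A \<omega> / measure M A))"
    unfolding uniform_measure_def emeasure_eq_measure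
    using assms(3) by (intro arg_cong[where f="density M"] ext)
      (simp add: divide_ennreal[symmetric] ennreal_indicator)
  hence "event_cond_exp M Y A = (\<integral>\<omega>. indicator A \<omega> / measure M A * Y \<omega> \<partial>M)"
    unfolding event_cond_exp_def using assms by (simp add: integral_real_density)
  also have "\<dots> = (\<integral>\<omega>. (indicator A \<omega> * Y \<omega>) / measure M A \<partial>M)"
    by (intro Bochner_Integration.integral_cong) auto
  finally show ?thesis by simp
qed

theorem theorem3p1:
  fixes M :: "'a measure" and X :: "'a \<Rightarrow> real" and \<alpha> \<beta> x :: real and n :: nat
  assumes "prob_space M"
    and "\<alpha> > 0" and "\<beta> > 0"
    and "distributed M lborel X (\<lambda>y. ennreal (ug_density \<alpha> \<beta> y))"
    and "n \<ge> 1"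
    and "0 < x" and "x < 1"
  shows "event_cond_exp M (\<lambda>\<omega>. X \<omega> ^ n) {\<omega> \<in> space M. X \<omega> > x} =
    exp \<alpha> * \<alpha> powr (real n / \<beta>) *
      (upper_inc_gamma (1 - real n / \<beta>) \<alpha> -
       upper_inc_gamma (1 - real n / \<beta>) (\<alpha> / x powr \<beta>)) /
    (1 - exp (- \<alpha> * (1 / x powr \<beta> - 1)))"
proof -
  interpret prob_space M by fact
  let ?A = "{\<omega> \<in> space M. X \<omega> > x}"
  have X [measurable]: "X \<in> borel_measurable M"
    using distributed_measurable[OF assms(4)] by simp
  have A: "?A \<in> sets M" by measurable
  \<comment> \<open>Kept general in \<open>m\<close>: the numerator is the case
    \<open>m = n\<close>, the probability of the event the case \<open>m = 0\<close>.\<close>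
  have moment: "(\<integral>\<omega>. indicator ?A \<omega> * X \<omega> ^ m \<partial>M) = exp \<alpha> * \<alpha> powr (real m / \<beta>) *
      (LBINT t=\<alpha>..\<alpha> / x powr \<beta>. t powr (- real m / \<beta>) * exp (- t))" for m
  proof -
    have "(\<integral>\<omega>. indicator ?A \<omega> * X \<omega> ^ m \<partial>M) = (\<integral>\<omega>. indicator {x<..} (X \<omega>) * X \<omega> ^ m \<partial>M)"
      by (intro Bochner_Integration.integral_cong) (auto simp: indicator_def)
    also have "\<dots> = (\<integral>y. ug_density \<alpha> \<beta> y * (indicator {x<..} y * y ^ m) \<partial>lborel)"
      by (rule distributed_integral[OF assms(4), symmetric])
        (use assms in \<open>auto intro: ug_density_nonneg\<close>)
    finally show ?thesis using assms by (simp add: ug_truncated_moment)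
  qed
  have xb: "0 < x powr \<beta>" "x powr \<beta> < 1"
    using assms powr_less_mono2[of \<beta> x 1] by auto
  have le: "\<alpha> \<le> \<alpha> / x powr \<beta>"
    using xb assms by (simp add: field_simps)
  have "measure M ?A = (\<integral>\<omega>. indicator ?A \<omega> * X \<omega> ^ 0 \<partial>M)"
    using A by simp
  also have "\<dots> = exp \<alpha> * (LBINT t=\<alpha>..\<alpha> / x powr \<beta>. t powr 0 * exp (- t))"
    unfolding moment using assms by simp
  \<comment> \<open>As \<open>0 powr 0 = 0\<close>, replacing \<open>t powr 0\<close> by 1 requires
    \<open>t \<noteq> 0\<close>; by \<open>le\<close> and \<open>\<alpha> > 0\<close> the whole
    interval is positive.\<close>
  also have "(LBINT t=\<alpha>..\<alpha> / x powr \<beta>. t powr 0 * exp (- t)) =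
      (LBINT t=\<alpha>..\<alpha> / x powr \<beta>. exp (- t))"
    using le assms by (intro interval_integral_cong) (auto simp: einterval_iff)
  also have "exp \<alpha> * \<dots> = 1 - exp (- \<alpha> * (1 / x powr \<beta> - 1))"
    by (simp add: interval_integral_exp_minus right_diff_distrib exp_add[symmetric])
  finally have prob: "measure M ?A = 1 - exp (- \<alpha> * (1 / x powr \<beta> - 1))" .
  have "- \<alpha> * (1 / x powr \<beta> - 1) < 0"
    using xb assms by (simp add: field_simps)
  hence "measure M ?A > 0" unfolding prob by (simp only: diff_gt_0_iff_gt exp_less_one_iff)
  hence "event_cond_exp M (\<lambda>\<omega>. X \<omega> ^ n) ?A =
      (\<integral>\<omega>. indicator ?A \<omega> * X \<omega> ^ n \<partial>M) / measure M ?A"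
    by (intro event_cond_exp_eq A finite_measure_axioms) auto
  thus ?thesis
    \<comment> \<open>The parameter \<open>1 - n / \<beta>\<close> is chosen so that
      \<open>s - 1\<close> is the exponent \<open>- n / \<beta>\<close> left by the
      substitution.\<close>
    unfolding moment prob using upper_inc_gamma_diff[OF assms(2) le, of "1 - real n / \<beta>"] by simp
qed

end
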